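(* Let $(R,S)$ be a relative Rota-Baxter system on a Leibniz algebra $(g,[\cdot,\cdot]_g)$ (over a field $\mathbb K$ of characteristic zero) with respect to a representation $(V,\rho^L,\rho^R)$. The cohomology class of the infinitesimal of a formal deformation of $(R,S)$ depends only on the equivalence class of the deformation. That is, if $(R_t=\sum_{i\ge0}\mathfrak R_it^i,\ S_t=\sum_{i\ge0}\mathfrak S_it^i)$ and $(R'_t=\sum_{i\ge0}\mathfrak R'_it^i,\ S'_t=\sum_{i\ge0}\mathfrak S'_it^i)$ are equivalent formal deformations of $(R,S)$, then their infinitesimals $(\mathfrak R_1,\mathfrak S_1)$ and $(\mathfrak R'_1,\mathfrak S'_1)$ are cohomologous, i.e. their difference is of the form $d_{(R,S)}(x,y)$ for some $(x,y)\in g\oplus g$.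
   Context: A Leibniz algebra is a vector space $g$ with a bilinear bracket satisfying $[x,[y,z]_g]_g=[[x,y]_g,z]_g+[y,[x,z]_g]_g$. A representation is a triple $(V,\rho^L,\rho^R)$ with $\rho^L,\rho^R:g\to gl(V)$ linear such that $\rho^L([x,y]_g)=[\rho^L(x),\rho^L(y)]$, $\rho^R([x,y]_g)=[\rho^L(x),\rho^R(y)]$, $\rho^R(y)\circ\rho^L(x)=-\rho^R(y)\circ\rho^R(x)$. A relative Rota-Baxter system with respect to $(V,\rho^L,\rho^R)$ is a pair $(R,S)$ of linear maps $V\to g$ with $[Ru,Rv]_g=R(\rho^L(Ru)v+\rho^R(Sv)u)$ and $[Su,Sv]_g=S(\rho^L(Ru)v+\rho^R(Sv)u)$ for all $u,v\in V$. The bracket of $g$ and the maps $\rho^L,\rho^R$ are extended $\mathbb K[[t]]$-bilinearly to $g[[t]]$ and $V[[t]]$. A formal deformation of $(R,S)$ is a pair $R_t=\sum_{i\ge0}\mathfrak R_it^i$, $S_t=\sum_{i\ge0}\mathfrak S_it^i$ with $\mathfrak R_i,\mathfrak S_i\in\mathrm{Hom}_{\mathbb K}(V,g)$, $\mathfrak R_0=R$, $\mathfrak S_0=S$, satisfying $[R_tu,R_tv]_g=R_t(\rho^L(R_tu)v+\rho^R(S_tv)u)$ and $[S_tu,S_tv]_g=S_t(\rho^L(R_tu)v+\rho^R(S_tv)u)$ for $u,v\in V$. The pair $(\mathfrak R_1,\mathfrak S_1)$ is the infinitesimal of the deformation; it is a 1-cocycle in the cohomology of $(R,S)$, i.e.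 for all $u,v\in V$, $[Ru,\mathfrak R_1v]_g+[\mathfrak R_1u,Rv]_g=\mathfrak R_1(\rho^L(Ru)v+\rho^R(Sv)u)+R(\rho^L(\mathfrak R_1u)v+\rho^R(\mathfrak S_1v)u)$ and $[Su,\mathfrak S_1v]_g+[\mathfrak S_1u,Sv]_g=\mathfrak S_1(\rho^L(Ru)v+\rho^R(Sv)u)+S(\rho^L(\mathfrak R_1u)v+\rho^R(\mathfrak S_1v)u)$. Let $L_xz=[x,z]_g$ and $R_xz=[z,x]_g$ denote left and right multiplication. Two formal deformations $(R_t,S_t)$ and $(R'_t,S'_t)$ of $(R,S)$ are equivalent if there exist $x,y\in g$ and linear maps $\phi_i,\varphi_i\in gl(g)$, $\psi_i\in gl(V)$ for $i\ge2$ such that, with $\phi_t=\mathrm{Id}_g+t(L_x-R_x)+\sum_{i\ge2}\phi_it^i$, $\varphi_t=\mathrm{Id}_g+t(L_y-R_y)+\sum_{i\ge2}\varphi_it^i$, $\psi_t=\mathrm{Id}_V+t(\rho^L(x)-\rho^R(y))+\sum_{i\ge2}\psi_it^i$, for all $z,w\in g$, $u\in V$: (i) $[\phi_t(z),\phi_t(w)]_g=\phi_t([z,w]_g)$ and $[\varphi_t(z),\varphi_t(w)]_g=\varphi_t([z,w]_g)$; (ii) $\psi_t(\rho^L(z)u)=\rho^L(\phi_t(z))\psi_t(u)$; (iii) $\psi_t(\rho^R(z)u)=\rho^R(\varphi_t(z))\psi_t(u)$; (iv) $R'_t\circ\psi_t(u)=\phi_t\circ R_t(u)$ and $S'_t\circ\psi_t(u)=\varphi_t\circ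 S_t(u)$. In degree $0$, for $(x,y)\in g\oplus g$, $d_{(R,S)}(x,y)$ is the pair of linear maps $V\to g$ whose first component is $u\mapsto [Ru,x]_g-R(\rho^R(y)u)-[x,Ru]_g+R(\rho^L(x)u)$ and whose second component is $u\mapsto [Su,y]_g-S(\rho^R(y)u)-[y,Su]_g+S(\rho^L(x)u)$. Two 1-cocycles are cohomologous (have the same cohomology class) if their difference is of the form $d_{(R,S)}(x,y)$. *)

theory Defs
  imports "HOL-Computational_Algebra.Formal_Power_Series"
begin

locale leibniz_algebra = vector_space scaleG
  for scaleG :: "'k::field_char_0 \<Rightarrow> 'g::ab_group_add \<Rightarrow> 'g" +
  fixes bracket :: "'g \<Rightarrow> 'g \<Rightarrow> 'g"
  assumes bracket_linear_left: "Vector_Spaces.linear scaleG scaleG (\<lambda>x. bracket x y)"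
    and bracket_linear_right: "Vector_Spaces.linear scaleG scaleG (\<lambda>y. bracket x y)"
    and leibniz_identity:
      "bracket x (bracket y z) = bracket (bracket x y) z + bracket y (bracket x z)"

text \<open>
  A linear map \<open>g \<rightarrow> gl(V)\<close> is a function \<open>'g \<Rightarrow> 'v \<Rightarrow> 'v\<close> that is linear in each argument.
\<close>

locale leibniz_representation = leibniz_algebra scaleG bracket + V: vector_space scaleV
  for scaleG :: "'k::field_char_0 \<Rightarrow> 'g::ab_group_add \<Rightarrow> 'g"
    and bracket :: "'g \<Rightarrow> 'g \<Rightarrow> 'g"
    and scaleV :: "'k \<Rightarrow> 'v::ab_group_add \<Rightarrow> 'v" +
  fixes rhoL rhoR :: "'g \<Rightarrow> 'v \<Rightarrow> 'v"
  assumes rhoL_linear_left: "Vector_Spaces.linear scaleG scaleV (\<lambda>x. rhoL x v)"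
    and rhoL_linear_right: "Vector_Spaces.linear scaleV scaleV (rhoL x)"
    and rhoR_linear_left: "Vector_Spaces.linear scaleG scaleV (\<lambda>x. rhoR x v)"
    and rhoR_linear_right: "Vector_Spaces.linear scaleV scaleV (rhoR x)"
    and rhoL_bracket: "rhoL (bracket x y) v = rhoL x (rhoL y v) - rhoL y (rhoL x v)"
    and rhoR_bracket: "rhoR (bracket x y) v = rhoL x (rhoR y v) - rhoR y (rhoL x v)"
    and rhoR_rhoL: "rhoR y (rhoL x v) = - rhoR y (rhoR x v)"

locale relative_rota_baxter_system =
  leibniz_representation scaleG bracket scaleV rhoL rhoR
  for scaleG :: "'k::field_char_0 \<Rightarrow> 'g::ab_group_add \<Rightarrow> 'g"
    and bracket :: "'g \<Rightarrow> 'g \<Rightarrow> 'g"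
    and scaleV :: "'k \<Rightarrow> 'v::ab_group_add \<Rightarrow> 'v"
    and rhoL rhoR :: "'g \<Rightarrow> 'v \<Rightarrow> 'v" +
  fixes R S :: "'v \<Rightarrow> 'g"
  assumes R_linear: "Vector_Spaces.linear scaleV scaleG R"
    and S_linear: "Vector_Spaces.linear scaleV scaleG S"
    and R_bracket: "bracket (R u) (R v) = R (rhoL (R u) v + rhoR (S v) u)"
    and S_bracket: "bracket (S u) (S v) = S (rhoL (R u) v + rhoR (S v) u)"

text \<open>
  The \<open>K[[t]]\<close>-bilinear extension of a bilinear map \<open>b\<close>: the coefficient of \<open>t\<^sup>n\<close> in
  \<open>b(F, G)\<close> is the sum of all \<open>b(F\<^sub>i, G\<^sub>j)\<close> with \<open>i + j = n\<close>.  Elements of \<open>g[[t]]\<close> and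
  \<open>V[[t]]\<close> have type \<open>'g fps\<close> and \<open>'v fps\<close>; an element of \<open>g\<close> or \<open>V\<close> is viewed as a constant
  series by \<open>fps_const\<close>.
\<close>

definition fps_bilinear_ext :: "('a \<Rightarrow> 'b \<Rightarrow> 'c::comm_monoid_add) \<Rightarrow> 'a fps \<Rightarrow> 'b fps \<Rightarrow> 'c fps"
  where "fps_bilinear_ext b F G = Abs_fps (\<lambda>n. \<Sum>i\<le>n. b (fps_nth F i) (fps_nth G (n - i)))"

text \<open>
  A series of maps, such as \<open>R\<^sub>t\<close>, has type \<open>('a \<Rightarrow> 'b) fps\<close>.  It acts on series by extending
  the evaluation map \<open>(f, a) \<mapsto> f a\<close>.
\<close>

definition fps_map_apply :: "('a \<Rightarrow> 'b::comm_monoid_add) fps \<Rightarrow> 'a fps \<Rightarrow> 'b fps"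
  where "fps_map_apply = fps_bilinear_ext (\<lambda>f a. f a)"

definition formal_deformation ::
  "('k::field_char_0 \<Rightarrow> 'g::ab_group_add \<Rightarrow> 'g) \<Rightarrow> ('g \<Rightarrow> 'g \<Rightarrow> 'g) \<Rightarrow>
   ('k \<Rightarrow> 'v::ab_group_add \<Rightarrow> 'v) \<Rightarrow> ('g \<Rightarrow> 'v \<Rightarrow> 'v) \<Rightarrow> ('g \<Rightarrow> 'v \<Rightarrow> 'v) \<Rightarrow>
   ('v \<Rightarrow> 'g) \<Rightarrow> ('v \<Rightarrow> 'g) \<Rightarrow> ('v \<Rightarrow> 'g) fps \<Rightarrow> ('v \<Rightarrow> 'g) fps \<Rightarrow> bool"
  where "formal_deformation scaleG bracket scaleV rhoL rhoR R S Rt St \<longleftrightarrow>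
    (\<forall>i. Vector_Spaces.linear scaleV scaleG (fps_nth Rt i)) \<and>
    (\<forall>i. Vector_Spaces.linear scaleV scaleG (fps_nth St i)) \<and>
    fps_nth Rt 0 = R \<and> fps_nth St 0 = S \<and>
    (\<forall>u v.
      (let ut = fps_const u; vt = fps_const v;
           wt = fps_bilinear_ext rhoL (fps_map_apply Rt ut) vt +
                fps_bilinear_ext rhoR (fps_map_apply St vt) ut
       in fps_bilinear_ext bracket (fps_map_apply Rt ut) (fps_map_apply Rt vt)
            = fps_map_apply Rt wt \<and>
          fps_bilinear_ext bracket (fps_map_apply St ut) (fps_map_apply St vt)
            = fps_map_apply St wt))"

definition equivalent_deformations ::
  "('k::field_char_0 \<Rightarrow> 'g::ab_group_add \<Rightarrow> 'g) \<Rightarrow> ('g \<Rightarrow> 'g \<Rightarrow> 'g) \<Rightarrow>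
   ('k \<Rightarrow> 'v::ab_group_add \<Rightarrow> 'v) \<Rightarrow> ('g \<Rightarrow> 'v \<Rightarrow> 'v) \<Rightarrow> ('g \<Rightarrow> 'v \<Rightarrow> 'v) \<Rightarrow>
   ('v \<Rightarrow> 'g) fps \<Rightarrow> ('v \<Rightarrow> 'g) fps \<Rightarrow> ('v \<Rightarrow> 'g) fps \<Rightarrow> ('v \<Rightarrow> 'g) fps \<Rightarrow> bool"
  where "equivalent_deformations scaleG bracket scaleV rhoL rhoR Rt St Rt' St' \<longleftrightarrow>
    (\<exists>x y (phi :: ('g \<Rightarrow> 'g) fps) (vphi :: ('g \<Rightarrow> 'g) fps) (psi :: ('v \<Rightarrow> 'v) fps).
      fps_nth phi 0 = id \<and> fps_nth phi 1 = (\<lambda>z. bracket x z - bracket z x) \<and>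
      fps_nth vphi 0 = id \<and> fps_nth vphi 1 = (\<lambda>z. bracket y z - bracket z y) \<and>
      fps_nth psi 0 = id \<and> fps_nth psi 1 = (\<lambda>u. rhoL x u - rhoR y u) \<and>
      (\<forall>i\<ge>2. Vector_Spaces.linear scaleG scaleG (fps_nth phi i) \<and>
              Vector_Spaces.linear scaleG scaleG (fps_nth vphi i) \<and>
              Vector_Spaces.linear scaleV scaleV (fps_nth psi i)) \<and>
      (\<forall>z w.
        fps_bilinear_ext bracket (fps_map_apply phi (fps_const z)) (fps_map_apply phi (fps_const w))
          = fps_map_apply phi (fps_const (bracket z w)) \<and>
        fps_bilinear_ext bracket (fps_map_apply vphi (fps_const z)) (fps_map_apply vphi (fps_const w))
          = fps_map_apply vphi (fps_const (bracket z w))) \<and>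
      (\<forall>z u. fps_map_apply psi (fps_const (rhoL z u))
        = fps_bilinear_ext rhoL (fps_map_apply phi (fps_const z)) (fps_map_apply psi (fps_const u))) \<and>
      (\<forall>z u. fps_map_apply psi (fps_const (rhoR z u))
        = fps_bilinear_ext rhoR (fps_map_apply vphi (fps_const z)) (fps_map_apply psi (fps_const u))) \<and>
      (\<forall>u.
        fps_map_apply Rt' (fps_map_apply psi (fps_const u))
          = fps_map_apply phi (fps_map_apply Rt (fps_const u)) \<and>
        fps_map_apply St' (fps_map_apply psi (fps_const u))
          = fps_map_apply vphi (fps_map_apply St (fps_const u))))"

definition infinitesimal ::
  "('v \<Rightarrow> 'g) fps \<Rightarrow> ('v \<Rightarrow> 'g) fps \<Rightarrow> ('v \<Rightarrow> 'g) \<times> ('v \<Rightarrow> 'g)"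
  where "infinitesimal Rt St = (fps_nth Rt 1, fps_nth St 1)"

definition one_cocycle ::
  "('k::field_char_0 \<Rightarrow> 'g::ab_group_add \<Rightarrow> 'g) \<Rightarrow> ('g \<Rightarrow> 'g \<Rightarrow> 'g) \<Rightarrow>
   ('k \<Rightarrow> 'v::ab_group_add \<Rightarrow> 'v) \<Rightarrow> ('g \<Rightarrow> 'v \<Rightarrow> 'v) \<Rightarrow> ('g \<Rightarrow> 'v \<Rightarrow> 'v) \<Rightarrow>
   ('v \<Rightarrow> 'g) \<Rightarrow> ('v \<Rightarrow> 'g) \<Rightarrow> ('v \<Rightarrow> 'g) \<times> ('v \<Rightarrow> 'g) \<Rightarrow> bool"
  where "one_cocycle scaleG bracket scaleV rhoL rhoR R S = (\<lambda>(A, B).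
    Vector_Spaces.linear scaleV scaleG A \<and> Vector_Spaces.linear scaleV scaleG B \<and>
    (\<forall>u v.
      bracket (R u) (A v) + bracket (A u) (R v)
        = A (rhoL (R u) v + rhoR (S v) u) + R (rhoL (A u) v + rhoR (B v) u) \<and>
      bracket (S u) (B v) + bracket (B u) (S v)
        = B (rhoL (R u) v + rhoR (S v) u) + S (rhoL (A u) v + rhoR (B v) u)))"

definition zero_differential ::
  "('g::ab_group_add \<Rightarrow> 'g \<Rightarrow> 'g) \<Rightarrow> ('g \<Rightarrow> 'v \<Rightarrow> 'v) \<Rightarrow> ('g \<Rightarrow> 'v \<Rightarrow> 'v) \<Rightarrow>
   ('v \<Rightarrow> 'g) \<Rightarrow> ('v \<Rightarrow> 'g) \<Rightarrow> 'g \<times> 'g \<Rightarrow> ('v \<Rightarrow> 'g) \<times> ('v \<Rightarrow> 'g)"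
  where "zero_differential bracket rhoL rhoR R S = (\<lambda>(x, y).
    ((\<lambda>u. bracket (R u) x - R (rhoR y u) - bracket x (R u) + R (rhoL x u)),
     (\<lambda>u. bracket (S u) y - S (rhoR y u) - bracket y (S u) + S (rhoL x u))))"

definition cohomologous ::
  "('k::field_char_0 \<Rightarrow> 'g::ab_group_add \<Rightarrow> 'g) \<Rightarrow> ('g \<Rightarrow> 'g \<Rightarrow> 'g) \<Rightarrow>
   ('k \<Rightarrow> 'v::ab_group_add \<Rightarrow> 'v) \<Rightarrow> ('g \<Rightarrow> 'v \<Rightarrow> 'v) \<Rightarrow> ('g \<Rightarrow> 'v \<Rightarrow> 'v) \<Rightarrow>
   ('v \<Rightarrow> 'g) \<Rightarrow> ('v \<Rightarrow> 'g) \<Rightarrow>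
   ('v \<Rightarrow> 'g) \<times> ('v \<Rightarrow> 'g) \<Rightarrow> ('v \<Rightarrow> 'g) \<times> ('v \<Rightarrow> 'g) \<Rightarrow> bool"
  where "cohomologous scaleG bracket scaleV rhoL rhoR R S c c' \<longleftrightarrow>
    one_cocycle scaleG bracket scaleV rhoL rhoR R S c \<and>
    one_cocycle scaleG bracket scaleV rhoL rhoR R S c' \<and>
    (\<exists>x y. ((\<lambda>u. fst c u - fst c' u), (\<lambda>u. snd c u - snd c' u))
            = zero_differential bracket rhoL rhoR R S (x, y))"

end

theory Submission
  imports Defs
begin

text \<open>
  Everything happens modulo \<open>t\<^sup>2\<close>.  Since \<open>\<phi>\<^sub>t\<close> and \<open>\<psi>\<^sub>t\<close> begin with the identity, the coefficient of
  \<open>t\<close> in the intertwining relation \<open>R'\<^sub>t \<circ> \<psi>\<^sub>t = \<phi>\<^sub>t \<circ> R\<^sub>t\<close> is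
  \<open>R(\<psi>\<^sub>1 u) + R'\<^sub>1 u = R\<^sub>1 u + \<phi>\<^sub>1(R u)\<close>,
  so \<open>R\<^sub>1 - R'\<^sub>1 = R \<circ> \<psi>\<^sub>1 - \<phi>\<^sub>1 \<circ> R\<close> (\<open>intertwining_first_order\<close>).  With
  \<open>\<phi>\<^sub>1 z = [x, z] - [z, x]\<close> and \<open>\<psi>\<^sub>1 = \<rho>\<^sup>L(x) - \<rho>\<^sup>R(y)\<close> this is the first component of the
  differential of \<open>(x, y)\<close>; the second one arises in the same way from \<open>S\<^sub>t\<close>, \<open>\<phi>\<close> being replaced by
  \<open>\<varphi>\<close>.  Being cohomologous also demands that both infinitesimals are cocycles; this is the
  coefficient of \<open>t\<close> in the deformation equations, read off in
  \<open>infinitesimal_is_one_cocycle\<close>.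
\<close>

lemma fps_bilinear_ext_nth_0:
  "fps_nth (fps_bilinear_ext b F G) 0 = b (fps_nth F 0) (fps_nth G 0)"
  by (simp add: fps_bilinear_ext_def)

lemma fps_bilinear_ext_nth_1:
  "fps_nth (fps_bilinear_ext b F G) 1
     = b (fps_nth F 0) (fps_nth G 1) + b (fps_nth F 1) (fps_nth G 0)"
  by (simp add: fps_bilinear_ext_def)

lemmas fps_map_apply_nth_0 =
  fps_bilinear_ext_nth_0[of "\<lambda>f a. f a", folded fps_map_apply_def]

lemmas fps_map_apply_nth_1 =
  fps_bilinear_ext_nth_1[of "\<lambda>f a. f a", folded fps_map_apply_def]

lemmas low_order_coefficients =
  fps_bilinear_ext_nth_0 fps_bilinear_ext_nth_1 fps_map_apply_nth_0 fps_map_apply_nth_1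

lemma fps_const_nth_0: "fps_nth (fps_const c) 0 = c"
  by simp

lemma fps_const_nth_1: "fps_nth (fps_const c) 1 = 0"
  by simp

lemma linear_map_zero:
  assumes "Vector_Spaces.linear s1 s2 f"
  shows "f 0 = 0"
proof -
  interpret Vector_Spaces.linear s1 s2 f by (fact assms)
  show ?thesis by (fact zero)
qed

lemma linear_map_diff:
  assumes "Vector_Spaces.linear s1 s2 f"
  shows "f (a - b) = f a - f b"
proof -
  interpret Vector_Spaces.linear s1 s2 f by (fact assms)
  show ?thesis by (fact diff)
qed

text \<open>
  The product rule turns the coefficient of \<open>t\<close> in each deformation equation into the
  corresponding cocycle equation; the terms that pair a coefficient with the vanishing
  \<open>t\<close>-coefficient of a constant series drop out by linearity.
\<close>

lemma (in relative_rota_baxter_system) infinitesimal_is_one_cocycle: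
  assumes "formal_deformation scaleG bracket scaleV rhoL rhoR R S Rt St"
  shows "one_cocycle scaleG bracket scaleV rhoL rhoR R S (infinitesimal Rt St)"
proof -
  have linR: "\<And>i. Vector_Spaces.linear scaleV scaleG (fps_nth Rt i)"
    and linS: "\<And>i. Vector_Spaces.linear scaleV scaleG (fps_nth St i)"
    and base: "fps_nth Rt 0 = R" "fps_nth St 0 = S"
    using assms by (auto simp: formal_deformation_def)
  define W where "W u v =
      fps_bilinear_ext rhoL (fps_map_apply Rt (fps_const u)) (fps_const v) +
      fps_bilinear_ext rhoR (fps_map_apply St (fps_const v)) (fps_const u)" for u v
  have eqR: "fps_bilinear_ext bracket (fps_map_apply Rt (fps_const u)) (fps_map_apply Rt (fps_const v))
      = fps_map_apply Rt (W u v)"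
    and eqS: "fps_bilinear_ext bracket (fps_map_apply St (fps_const u)) (fps_map_apply St (fps_const v))
      = fps_map_apply St (W u v)" for u v
    using assms unfolding formal_deformation_def W_def Let_def by blast+
  note zeros = linear_map_zero[OF R_linear] linear_map_zero[OF S_linear]
    linear_map_zero[OF rhoL_linear_right] linear_map_zero[OF rhoR_linear_right]
  note coeffs = low_order_coefficients fps_const_nth_1 fps_const_nth_0 base zeros
    add_0_left add_0_right
  have W0: "fps_nth (W u v) 0 = rhoL (R u) v + rhoR (S v) u" for u v
    by (simp only: W_def fps_add_nth coeffs)
  have W1: "fps_nth (W u v) 1 = rhoL (fps_nth Rt 1 u) v + rhoR (fps_nth St 1 v) u" for u v
    by (simp only: W_def fps_add_nth coeffs)
  have "bracket (R u) (fps_nth Rt 1 v) + bracket (fps_nth Rt 1 u) (R v)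
      = fps_nth Rt 1 (rhoL (R u) v + rhoR (S v) u)
        + R (rhoL (fps_nth Rt 1 u) v + rhoR (fps_nth St 1 v) u)" for u v
    using arg_cong[OF eqR[of u v], of "\<lambda>F. fps_nth F 1"]
    by (simp only: coeffs W0 W1 add.commute)
  moreover have "bracket (S u) (fps_nth St 1 v) + bracket (fps_nth St 1 u) (S v)
      = fps_nth St 1 (rhoL (R u) v + rhoR (S v) u)
        + S (rhoL (fps_nth Rt 1 u) v + rhoR (fps_nth St 1 v) u)" for u v
    using arg_cong[OF eqS[of u v], of "\<lambda>F. fps_nth F 1"]
    by (simp only: coeffs W0 W1 add.commute)
  ultimately show ?thesis
    using linR linS by (simp only: one_cocycle_def infinitesimal_def prod.case simp_thms)
qed

text \<open>
  This single computation serves both components of the differential: it is applied to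
  \<open>(R\<^sub>t, \<phi>\<^sub>t)\<close> and to \<open>(S\<^sub>t, \<varphi>\<^sub>t)\<close>, with the same \<open>\<psi>\<^sub>t\<close>.
\<close>

lemma intertwining_first_order:
  fixes Tt Tt' :: "('v::ab_group_add \<Rightarrow> 'g::ab_group_add) fps"
  assumes intertwine: "fps_map_apply Tt' (fps_map_apply psi (fps_const u))
      = fps_map_apply phi (fps_map_apply Tt (fps_const u))"
    and base: "fps_nth Tt 0 = T" "fps_nth Tt' 0 = T"
    and leading: "T 0 = 0" "fps_nth phi 0 = id" "fps_nth psi 0 = id"
  shows "fps_nth Tt 1 u - fps_nth Tt' 1 u = T (fps_nth psi 1 u) - fps_nth phi 1 (T u)"
proof -
  have "T (fps_nth psi 1 u) + fps_nth Tt' 1 u = fps_nth Tt 1 u + fps_nth phi 1 (T u)"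
    using arg_cong[OF intertwine, of "\<lambda>F. fps_nth F 1"]
    by (simp only: low_order_coefficients fps_const_nth_1 fps_const_nth_0 base leading id_apply
        add_0_left add_0_right)
  then show ?thesis
    by (simp add: algebra_simps)
qed

theorem theorem5p5:
  fixes scaleG :: "'k::field_char_0 \<Rightarrow> 'g::ab_group_add \<Rightarrow> 'g"
    and scaleV :: "'k \<Rightarrow> 'v::ab_group_add \<Rightarrow> 'v"
    and bracket :: "'g \<Rightarrow> 'g \<Rightarrow> 'g"
    and rhoL rhoR :: "'g \<Rightarrow> 'v \<Rightarrow> 'v"
    and R S :: "'v \<Rightarrow> 'g"
    and Rt St Rt' St' :: "('v \<Rightarrow> 'g) fps"
  assumes "relative_rota_baxter_system scaleG bracket scaleV rhoL rhoR R S"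
    and "formal_deformation scaleG bracket scaleV rhoL rhoR R S Rt St"
    and "formal_deformation scaleG bracket scaleV rhoL rhoR R S Rt' St'"
    and "equivalent_deformations scaleG bracket scaleV rhoL rhoR Rt St Rt' St'"
  shows "cohomologous scaleG bracket scaleV rhoL rhoR R S
           (infinitesimal Rt St) (infinitesimal Rt' St')"
proof -
  interpret relative_rota_baxter_system scaleG bracket scaleV rhoL rhoR R S
    by (fact assms(1))
  have base: "fps_nth Rt 0 = R" "fps_nth St 0 = S" "fps_nth Rt' 0 = R" "fps_nth St' 0 = S"
    using assms(2,3) by (auto simp: formal_deformation_def)
  obtain x y phi vphi psi where
      id: "fps_nth phi 0 = id" "fps_nth vphi 0 = id" "fps_nth psi 0 = id"
    and phi1: "fps_nth phi 1 = (\<lambda>z. bracket x z - bracket z x)"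
    and vphi1: "fps_nth vphi 1 = (\<lambda>z. bracket y z - bracket z y)"
    and psi1: "fps_nth psi 1 = (\<lambda>u. rhoL x u - rhoR y u)"
    and intR: "\<And>u. fps_map_apply Rt' (fps_map_apply psi (fps_const u))
          = fps_map_apply phi (fps_map_apply Rt (fps_const u))"
    and intS: "\<And>u. fps_map_apply St' (fps_map_apply psi (fps_const u))
          = fps_map_apply vphi (fps_map_apply St (fps_const u))"
    using assms(4) unfolding equivalent_deformations_def by blast
  have "fps_nth Rt 1 u - fps_nth Rt' 1 u
      = bracket (R u) x - R (rhoR y u) - bracket x (R u) + R (rhoL x u)" for u
    using intertwining_first_order[OF intR base(1,3) linear_map_zero[OF R_linear] id(1,3)]
    by (simp add: phi1[simplified] psi1[simplified] linear_map_diff[OF R_linear])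
  moreover have "fps_nth St 1 u - fps_nth St' 1 u
      = bracket (S u) y - S (rhoR y u) - bracket y (S u) + S (rhoL x u)" for u
    using intertwining_first_order[OF intS base(2,4) linear_map_zero[OF S_linear] id(2,3)]
    by (simp add: vphi1[simplified] psi1[simplified] linear_map_diff[OF S_linear])
  ultimately have "((\<lambda>u. fst (infinitesimal Rt St) u - fst (infinitesimal Rt' St') u),
       (\<lambda>u. snd (infinitesimal Rt St) u - snd (infinitesimal Rt' St') u))
      = zero_differential bracket rhoL rhoR R S (x, y)"
    by (simp add: infinitesimal_def zero_differential_def)
  then show ?thesis
    using infinitesimal_is_one_cocycle[OF assms(2)] infinitesimal_is_one_cocycle[OF assms(3)]
    unfolding cohomologous_def by blast
qed

end
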